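(* Let $(M_n,g)$, $n>2$, be an $n$-dimensional Riemannian manifold with a unit vector field $\xi$ that is parallel with respect to the Levi-Civita connection $\nabla$, and let $\tilde\nabla$ be the projective semi-symmetric connection determined by $\pi=g(\cdot,\xi)$. Then $(M_n,g)$ is semi-symmetric with respect to $\tilde\nabla$, i.e. $\tilde R.\tilde R=0$, if and only if $(M_n,g)$ is flat with respect to $\nabla$, i.e. $R=0$.
   Context: $(M_n,g)$ is an $n$-dimensional Riemannian manifold with Levi-Civita connection $\nabla$; $\xi$ is a vector field with $g(\xi,\xi)=1$ and $\pi(X)=g(X,\xi)$. The projective semi-symmetric connection $\tilde\nabla$ is the linear connection $$\tilde\nabla_XY=\nabla_XY+\psi(Y)X+\psi(X)Y+\phi(Y)X-\phi(X)Y,\qquad \phi=\tfrac12\pi,\quad \psi=\tfrac{n-1}{2(n+1)}\pi ;$$ its torsion is $\tilde T(X,Y)=\pi(Y)X-\pi(X)Y$. $R$ and $\tilde R$ are the curvature tensors of $\nabla$ and $\tilde\nabla$, with $R(X,Y)Z=\nabla_X\nabla_YZ-\nabla_Y\nabla_XZ-\nabla_{[X,Y]}Z$ and likewise for $\tilde R$. The condition $\tilde R.\tilde R=0$ means that for all vector fields $X,Y,Z,U,V$, $$\tilde R(X,Y)\tilde R(Z,U)V-\tilde R(\tilde R(X,Y)Z,U)V-\tilde R(Z,\tilde R(X,Y)U)V-\tilde R(Z,U)\tilde R(X,Y)V=0.$$ *)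

theory Defs
  imports "HOL-Analysis.Analysis" "HOL-Library.Function_Algebras"
begin

text \<open>Only meaningful for open \<open>S\<close>, which is how it is used below.\<close>

primrec higher_differentiable_on ::
    "nat \<Rightarrow> 'e::euclidean_space set \<Rightarrow> ('e \<Rightarrow> 'f::real_normed_vector) \<Rightarrow> bool"
  where
    "higher_differentiable_on 0 S f \<longleftrightarrow> continuous_on S f"
  | "higher_differentiable_on (Suc k) S f \<longleftrightarrow>
       (\<forall>x\<in>S. f differentiable (at x)) \<and>
       (\<forall>v. higher_differentiable_on k S (\<lambda>x. frechet_derivative f (at x) v))"

definition smooth_on :: "'e::euclidean_space set \<Rightarrow> ('e \<Rightarrow> 'f::real_normed_vector) \<Rightarrow> bool"
  where "smooth_on S f \<longleftrightarrow> (\<forall>k. higher_differentiable_on k S f)"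

type_synonym ('a, 'e) chart = "'a set \<times> ('a \<Rightarrow> 'e)"

definition is_chart :: "'a topology \<Rightarrow> ('a, 'e::euclidean_space) chart \<Rightarrow> bool"
  where "is_chart M c \<longleftrightarrow> (case c of (U, \<phi>) \<Rightarrow>
    openin M U \<and> open (\<phi> ` U) \<and>
    homeomorphic_map (subtopology M U) (top_of_set (\<phi> ` U)) \<phi>)"

definition smooth_atlas :: "'a topology \<Rightarrow> ('a, 'e::euclidean_space) chart set \<Rightarrow> bool"
  where "smooth_atlas M A \<longleftrightarrow>
    (\<forall>c\<in>A. is_chart M c) \<and>
    (\<Union>(U, \<phi>)\<in>A. U) = topspace M \<and>
    (\<forall>(U, \<phi>)\<in>A. \<forall>(V, \<psi>)\<in>A. smooth_on (\<phi> ` (U \<inter> V)) (\<psi> \<circ> inv_into U \<phi>))"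

text \<open>The dimension of the manifold is the dimension \<open>DIM('e)\<close> of the model space. The atlas need
  not be maximal.\<close>

definition smooth_manifold :: "'a topology \<Rightarrow> ('a, 'e::euclidean_space) chart set \<Rightarrow> bool"
  where "smooth_manifold M A \<longleftrightarrow>
    Hausdorff_space M \<and> second_countable M \<and> smooth_atlas M A"

text \<open>Functions, tangent vectors and vector fields are total HOL functions; each is set to 0 outside
  its domain, so that HOL equality is equality of the mathematical objects.\<close>

definition smooth_functions ::
    "'a topology \<Rightarrow> ('a, 'e::euclidean_space) chart set \<Rightarrow> ('a \<Rightarrow> real) set"
  where "smooth_functions M A =
    {f. (\<forall>p. p \<notin> topspace M \<longrightarrow> f p = 0) \<and>
        (\<forall>(U, \<phi>)\<in>A. smooth_on (\<phi> ` U) (f \<circ> inv_into U \<phi>))}"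

text \<open>Tangent vectors at a point are the derivations at that point of the algebra of smooth
  functions.\<close>

type_synonym 'a tangent_vector = "('a \<Rightarrow> real) \<Rightarrow> real"

definition tangent_space ::
    "'a topology \<Rightarrow> ('a, 'e::euclidean_space) chart set \<Rightarrow> 'a \<Rightarrow> 'a tangent_vector set"
  where "tangent_space M A p =
    {v. (\<forall>f\<in>smooth_functions M A. \<forall>h\<in>smooth_functions M A. v (f + h) = v f + v h) \<and>
        (\<forall>c. \<forall>f\<in>smooth_functions M A. v (\<lambda>q. c * f q) = c * v f) \<and>
        (\<forall>f\<in>smooth_functions M A. \<forall>h\<in>smooth_functions M A. v (f * h) = f p * v h + h p * v f) \<and>
        (\<forall>f. f \<notin> smooth_functions M A \<longrightarrow> v f = 0)}"

type_synonym 'a vfield = "'a \<Rightarrow> 'a tangent_vector"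

definition vector_fields ::
    "'a topology \<Rightarrow> ('a, 'e::euclidean_space) chart set \<Rightarrow> 'a vfield set"
  where "vector_fields M A =
    {X. (\<forall>p\<in>topspace M. X p \<in> tangent_space M A p) \<and>
        (\<forall>p. p \<notin> topspace M \<longrightarrow> X p = 0) \<and>
        (\<forall>f\<in>smooth_functions M A. (\<lambda>p. X p f) \<in> smooth_functions M A)}"

definition fun_scale :: "('a \<Rightarrow> real) \<Rightarrow> 'a vfield \<Rightarrow> 'a vfield"  (infixr "\<odot>" 75)
  where "f \<odot> X = (\<lambda>p h. f p * X p h)"

definition lie_bracket :: "'a vfield \<Rightarrow> 'a vfield \<Rightarrow> 'a vfield"
  where "lie_bracket X Y = (\<lambda>p f. X p (\<lambda>q. Y q f) - Y p (\<lambda>q. X q f))"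


type_synonym 'a metric_field = "'a \<Rightarrow> 'a tangent_vector \<Rightarrow> 'a tangent_vector \<Rightarrow> real"

definition metric_fun ::
    "'a topology \<Rightarrow> 'a metric_field \<Rightarrow> 'a vfield \<Rightarrow> 'a vfield \<Rightarrow> 'a \<Rightarrow> real"
  where "metric_fun M g X Y = (\<lambda>p. if p \<in> topspace M then g p (X p) (Y p) else 0)"

definition riemannian_metric ::
    "'a topology \<Rightarrow> ('a, 'e::euclidean_space) chart set \<Rightarrow> 'a metric_field \<Rightarrow> bool"
  where "riemannian_metric M A g \<longleftrightarrow>
    (\<forall>p\<in>topspace M.
       (\<forall>u\<in>tangent_space M A p. \<forall>v\<in>tangent_space M A p. \<forall>w\<in>tangent_space M A p.
          g p (u + v) w = g p u w + g p v w) \<and>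
       (\<forall>c. \<forall>v\<in>tangent_space M A p. \<forall>w\<in>tangent_space M A p.
          g p (\<lambda>f. c * v f) w = c * g p v w) \<and>
       (\<forall>v\<in>tangent_space M A p. \<forall>w\<in>tangent_space M A p. g p v w = g p w v) \<and>
       (\<forall>v\<in>tangent_space M A p. v \<noteq> 0 \<longrightarrow> g p v v > 0)) \<and>
    (\<forall>X\<in>vector_fields M A. \<forall>Y\<in>vector_fields M A. metric_fun M g X Y \<in> smooth_functions M A)"

definition riemannian_manifold ::
    "'a topology \<Rightarrow> ('a, 'e::euclidean_space) chart set \<Rightarrow> 'a metric_field \<Rightarrow> bool"
  where "riemannian_manifold M A g \<longleftrightarrow> smooth_manifold M A \<and> riemannian_metric M A g"

type_synonym 'a connection = "'a vfield \<Rightarrow> 'a vfield \<Rightarrow> 'a vfield"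

definition linear_connection ::
    "'a topology \<Rightarrow> ('a, 'e::euclidean_space) chart set \<Rightarrow> 'a connection \<Rightarrow> bool"
  where "linear_connection M A D \<longleftrightarrow>
    (\<forall>X\<in>vector_fields M A. \<forall>Y\<in>vector_fields M A. D X Y \<in> vector_fields M A) \<and>
    (\<forall>X\<in>vector_fields M A. \<forall>Y\<in>vector_fields M A. \<forall>Z\<in>vector_fields M A.
       D (X + Y) Z = D X Z + D Y Z) \<and>
    (\<forall>f\<in>smooth_functions M A. \<forall>X\<in>vector_fields M A. \<forall>Y\<in>vector_fields M A.
       D (f \<odot> X) Y = f \<odot> D X Y) \<and>
    (\<forall>X\<in>vector_fields M A. \<forall>Y\<in>vector_fields M A. \<forall>Z\<in>vector_fields M A.
       D X (Y + Z) = D X Y + D X Z) \<and>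
    (\<forall>c. \<forall>X\<in>vector_fields M A. \<forall>Y\<in>vector_fields M A.
       D X ((\<lambda>_. c) \<odot> Y) = (\<lambda>_. c) \<odot> D X Y) \<and>
    (\<forall>f\<in>smooth_functions M A. \<forall>X\<in>vector_fields M A. \<forall>Y\<in>vector_fields M A.
       D X (f \<odot> Y) = (\<lambda>p. X p f) \<odot> Y + f \<odot> D X Y)"

definition torsion :: "'a connection \<Rightarrow> 'a vfield \<Rightarrow> 'a vfield \<Rightarrow> 'a vfield"
  where "torsion D X Y = D X Y - D Y X - lie_bracket X Y"

definition metric_connection ::
    "'a topology \<Rightarrow> ('a, 'e::euclidean_space) chart set \<Rightarrow> 'a metric_field \<Rightarrow> 'a connection \<Rightarrow> bool"
  where "metric_connection M A g D \<longleftrightarrow>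
    (\<forall>X\<in>vector_fields M A. \<forall>Y\<in>vector_fields M A. \<forall>Z\<in>vector_fields M A.
       (\<lambda>p. X p (metric_fun M g Y Z)) = metric_fun M g (D X Y) Z + metric_fun M g Y (D X Z))"

definition levi_civita_connection ::
    "'a topology \<Rightarrow> ('a, 'e::euclidean_space) chart set \<Rightarrow> 'a metric_field \<Rightarrow> 'a connection \<Rightarrow> bool"
  where "levi_civita_connection M A g D \<longleftrightarrow>
    linear_connection M A D \<and>
    (\<forall>X\<in>vector_fields M A. \<forall>Y\<in>vector_fields M A. torsion D X Y = 0) \<and>
    metric_connection M A g D"

definition unit_vector_field :: "'a topology \<Rightarrow> 'a metric_field \<Rightarrow> 'a vfield \<Rightarrow> bool"
  where "unit_vector_field M g \<xi> \<longleftrightarrow> (\<forall>p\<in>topspace M. metric_fun M g \<xi> \<xi> p = 1)"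

definition parallel_vector_field ::
    "'a topology \<Rightarrow> ('a, 'e::euclidean_space) chart set \<Rightarrow> 'a connection \<Rightarrow> 'a vfield \<Rightarrow> bool"
  where "parallel_vector_field M A D \<xi> \<longleftrightarrow> (\<forall>X\<in>vector_fields M A. D X \<xi> = 0)"

definition curvature ::
    "'a connection \<Rightarrow> 'a vfield \<Rightarrow> 'a vfield \<Rightarrow> 'a vfield \<Rightarrow> 'a vfield"
  where "curvature D X Y Z = D X (D Y Z) - D Y (D X Z) - D (lie_bracket X Y) Z"

definition flat_connection ::
    "'a topology \<Rightarrow> ('a, 'e::euclidean_space) chart set \<Rightarrow> 'a connection \<Rightarrow> bool"
  where "flat_connection M A D \<longleftrightarrow>
    (\<forall>X\<in>vector_fields M A. \<forall>Y\<in>vector_fields M A. \<forall>Z\<in>vector_fields M A. curvature D X Y Z = 0)"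

definition semi_symmetric ::
    "'a topology \<Rightarrow> ('a, 'e::euclidean_space) chart set \<Rightarrow> 'a connection \<Rightarrow> bool"
  where "semi_symmetric M A D \<longleftrightarrow>
    (\<forall>X\<in>vector_fields M A. \<forall>Y\<in>vector_fields M A. \<forall>Z\<in>vector_fields M A.
     \<forall>U\<in>vector_fields M A. \<forall>V\<in>vector_fields M A.
       curvature D X Y (curvature D Z U V)
       - curvature D (curvature D X Y Z) U V
       - curvature D Z (curvature D X Y U) V
       - curvature D Z U (curvature D X Y V) = 0)"

definition projective_semi_symmetric_connection ::
    "nat \<Rightarrow> ('a vfield \<Rightarrow> 'a \<Rightarrow> real) \<Rightarrow> 'a connection \<Rightarrow> 'a connection"
  where "projective_semi_symmetric_connection n \<pi> D X Y =
    (let \<phi> = (\<lambda>Z p. 1 / 2 * \<pi> Z p);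
         \<psi> = (\<lambda>Z p. (real n - 1) / (2 * (real n + 1)) * \<pi> Z p)
     in D X Y + \<psi> Y \<odot> X + \<psi> X \<odot> Y + \<phi> Y \<odot> X - \<phi> X \<odot> Y)"

end

theory Submission
  imports Defs
begin

text \<open>
  The metric enters only through the one-form \<open>\<eta> = g(\<cdot>, \<xi>)\<close>, which is parallel and satisfies
  \<open>\<eta>(\<xi>) = 1\<close>. The new connection is \<open>\<nabla>'\<^sub>X Y = \<nabla>\<^sub>X Y + a \<eta>(Y) X + b \<eta>(X) Y\<close> with \<open>a = n / (n + 1)\<close>; as
  \<open>\<nabla>\<close> is torsion free and \<open>\<eta>\<close> is parallel, all derivatives of \<open>\<eta>\<close> cancel in its curvature and
  \<open>R' = R + K\<close> with \<open>K(X, Y) Z = a\<^sup>2 \<eta>(Z) (\<eta>(Y) X - \<eta>(X) Y)\<close>.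
  Moreover \<open>\<eta> \<circ> R'(X, Y) = 0\<close>, so the derivation \<open>R'(X, Y)\<close> of the tensor algebra annihilates \<open>\<eta>\<close> and
  hence \<open>K\<close>, which is built from \<open>\<eta>\<close> alone. Thus \<open>R'.R' = R'.R\<close>. This is zero if \<open>R = 0\<close>; conversely,
  \<open>R(\<cdot>, \<cdot>) \<xi> = 0\<close> gives \<open>(R'(X, \<xi>).R)(Z, U) \<xi> = - R(Z, U) (R'(X, \<xi>) \<xi>) = - a\<^sup>2 R(Z, U) X\<close>.
\<close>

section \<open>Smooth functions\<close>

lemma higher_differentiable_on_has_derivative:
  assumes "higher_differentiable_on (Suc k) S f" "x \<in> S"
  shows "(f has_derivative frechet_derivative f (at x)) (at x)"
  using assms by (simp add: frechet_derivative_works)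

lemma higher_differentiable_on_cong:
  assumes "open S" "\<And>x. x \<in> S \<Longrightarrow> f x = h x" "higher_differentiable_on k S f"
  shows "higher_differentiable_on k S h"
  using assms(2,3)
proof (induction k arbitrary: f h)
  case 0
  then show ?case
    using continuous_on_cong[of S S f h] by simp
next
  case (Suc k)
  have has_derivative: "(h has_derivative frechet_derivative f (at x)) (at x)" if "x \<in> S" for x
    using higher_differentiable_on_has_derivative[OF Suc.prems(2) that] \<open>open S\<close> that
    by (rule has_derivative_transform_within_open) (rule Suc.prems(1))
  have "higher_differentiable_on k S (\<lambda>x. frechet_derivative h (at x) v)" for v
  proof (rule Suc.IH)
    show "frechet_derivative f (at x) v = frechet_derivative h (at x) v" if "x \<in> S" for x
      using frechet_derivative_at[OF has_derivative[OF that]] by simp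
  qed (use Suc.prems(2) in simp)
  then show ?case
    using has_derivative by (auto simp: differentiable_def)
qed

lemma higher_differentiable_on_SucI:
  assumes "open S" and f': "\<And>x. x \<in> S \<Longrightarrow> (f has_derivative f' x) (at x)"
    and "\<And>v. higher_differentiable_on k S (\<lambda>x. f' x v)"
  shows "higher_differentiable_on (Suc k) S f"
proof -
  have "higher_differentiable_on k S (\<lambda>x. frechet_derivative f (at x) v)" for v
    by (rule higher_differentiable_on_cong[OF assms(1) _ assms(3)])
       (simp add: frechet_derivative_at[OF f'])
  then show ?thesis
    using f' by (auto simp: differentiable_def)
qed

lemma higher_differentiable_on_SucD:
  "higher_differentiable_on (Suc k) S f \<Longrightarrow> higher_differentiable_on k S f"
proof (induction k arbitrary: f)
  case 0
  then show ?case
    by (auto intro!: continuous_at_imp_continuous_on differentiable_imp_continuous_within)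
next
  case (Suc k)
  have "\<forall>x\<in>S. f differentiable (at x)"
    and "higher_differentiable_on (Suc k) S (\<lambda>x. frechet_derivative f (at x) v)" for v
    using Suc.prems higher_differentiable_on.simps(2) by blast+
  then show ?case
    using Suc.IH by simp
qed

lemma higher_differentiable_on_const: "higher_differentiable_on k S (\<lambda>_. c)"
  by (induction k arbitrary: c) simp_all

lemma higher_differentiable_on_add:
  assumes "open S" "higher_differentiable_on k S f" "higher_differentiable_on k S h"
  shows "higher_differentiable_on k S (\<lambda>x. f x + h x)"
  using assms(2,3)
proof (induction k arbitrary: f h)
  case 0
  then show ?case by (simp add: continuous_on_add)
next
  case (Suc k)
  show ?case
  proof (rule higher_differentiable_on_SucI[OF \<open>open S\<close>])
    show "((\<lambda>x. f x + h x) has_derivative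
        (\<lambda>v. frechet_derivative f (at x) v + frechet_derivative h (at x) v)) (at x)"
      if "x \<in> S" for x
      using Suc.prems[THEN higher_differentiable_on_has_derivative, OF that]
      by (rule has_derivative_add)
  qed (use Suc in simp)
qed

lemma (in bounded_bilinear) higher_differentiable_on:
  assumes "open S" "higher_differentiable_on k S f" "higher_differentiable_on k S h"
  shows "higher_differentiable_on k S (\<lambda>x. prod (f x) (h x))"
  using assms(2,3)
proof (induction k arbitrary: f h)
  case 0
  then show ?case by (simp add: continuous_on)
next
  case (Suc k)
  show ?case
  proof (rule higher_differentiable_on_SucI[OF \<open>open S\<close>])
    show "((\<lambda>x. prod (f x) (h x)) has_derivative
        (\<lambda>v. prod (f x) (frechet_derivative h (at x) v)
          + prod (frechet_derivative f (at x) v) (h x))) (at x)"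
      if "x \<in> S" for x
      using Suc.prems[THEN higher_differentiable_on_has_derivative, OF that] by (rule FDERIV)
    show "higher_differentiable_on k S
        (\<lambda>x. prod (f x) (frechet_derivative h (at x) v)
          + prod (frechet_derivative f (at x) v) (h x))" for v
      using Suc.prems[THEN higher_differentiable_on_SucD] Suc.prems
      by (intro higher_differentiable_on_add \<open>open S\<close> Suc.IH) simp_all
  qed
qed

lemma smooth_on_cong:
  "open S \<Longrightarrow> (\<And>x. x \<in> S \<Longrightarrow> f x = h x) \<Longrightarrow> smooth_on S f \<Longrightarrow> smooth_on S h"
  unfolding smooth_on_def using higher_differentiable_on_cong by blast

lemma smooth_on_const: "smooth_on S (\<lambda>_. c)"
  by (simp add: smooth_on_def higher_differentiable_on_const)

lemma smooth_on_add: "open S \<Longrightarrow> smooth_on S f \<Longrightarrow> smooth_on S h \<Longrightarrow> smooth_on S (\<lambda>x. f x + h x)"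
  by (simp add: smooth_on_def higher_differentiable_on_add)

lemma smooth_on_mult:
  fixes f h :: "'e::euclidean_space \<Rightarrow> 'b::real_normed_algebra"
  shows "open S \<Longrightarrow> smooth_on S f \<Longrightarrow> smooth_on S h \<Longrightarrow> smooth_on S (\<lambda>x. f x * h x)"
  by (simp add: smooth_on_def bounded_bilinear.higher_differentiable_on[OF bounded_bilinear_mult])

locale manifold_atlas =
  fixes M :: "'a topology" and A :: "('a, 'e::euclidean_space) chart set"
  assumes smooth_atlas: "smooth_atlas M A"
begin

abbreviation "\<FF> \<equiv> smooth_functions M A"
abbreviation "\<XX> \<equiv> vector_fields M A"

lemma open_chart_image: "(U, \<phi>) \<in> A \<Longrightarrow> open (\<phi> ` U)"
  using smooth_atlas unfolding smooth_atlas_def is_chart_def by blast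

lemma chart_domain_subset: "(U, \<phi>) \<in> A \<Longrightarrow> U \<subseteq> topspace M"
  using smooth_atlas unfolding smooth_atlas_def is_chart_def by (blast dest: openin_subset)

lemma smooth_function_outside: "f \<in> \<FF> \<Longrightarrow> p \<notin> topspace M \<Longrightarrow> f p = 0"
  by (simp add: smooth_functions_def)

lemma smooth_functions_const: "(\<lambda>p. if p \<in> topspace M then c else 0) \<in> \<FF>"
proof -
  have "smooth_on (\<phi> ` U) ((\<lambda>p. if p \<in> topspace M then c else 0) \<circ> inv_into U \<phi>)"
    if chart: "(U, \<phi>) \<in> A" for U \<phi>
  proof (rule smooth_on_cong[OF open_chart_image[OF chart] _ smooth_on_const])
    show "c = ((\<lambda>p. if p \<in> topspace M then c else 0) \<circ> inv_into U \<phi>) x" if "x \<in> \<phi> ` U" for x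
      using inv_into_into[OF that] chart_domain_subset[OF chart] by auto
  qed
  then show ?thesis
    by (auto simp: smooth_functions_def)
qed

lemma smooth_functions_add: "f \<in> \<FF> \<Longrightarrow> h \<in> \<FF> \<Longrightarrow> (\<lambda>p. f p + h p) \<in> \<FF>"
  by (auto simp: smooth_functions_def comp_def intro!: smooth_on_add open_chart_image)

lemma smooth_functions_mult: "f \<in> \<FF> \<Longrightarrow> h \<in> \<FF> \<Longrightarrow> (\<lambda>p. f p * h p) \<in> \<FF>"
  by (auto simp: smooth_functions_def comp_def intro!: smooth_on_mult open_chart_image)

lemma smooth_functions_cmult: assumes "f \<in> \<FF>" shows "(\<lambda>p. c * f p) \<in> \<FF>"
proof -
  have "(\<lambda>p. c * f p) = (\<lambda>p. (if p \<in> topspace M then c else 0) * f p)"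
    using smooth_function_outside[OF assms] by auto
  then show ?thesis
    using smooth_functions_mult[OF smooth_functions_const assms] by simp
qed

lemma smooth_functions_diff: "f \<in> \<FF> \<Longrightarrow> h \<in> \<FF> \<Longrightarrow> (\<lambda>p. f p - h p) \<in> \<FF>"
  using smooth_functions_add[OF _ smooth_functions_cmult[of h "-1"], of f] by simp

section \<open>Vector fields\<close>

lemma tangent_space_add:
  "u \<in> tangent_space M A p \<Longrightarrow> v \<in> tangent_space M A p \<Longrightarrow> u + v \<in> tangent_space M A p"
  by (auto simp: tangent_space_def algebra_simps)

lemma tangent_space_scale:
  "u \<in> tangent_space M A p \<Longrightarrow> (\<lambda>f. c * u f) \<in> tangent_space M A p"
  by (auto simp: tangent_space_def algebra_simps)

lemma vector_field_outside: "X \<in> \<XX> \<Longrightarrow> p \<notin> topspace M \<Longrightarrow> X p f = 0"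
  by (simp add: vector_fields_def)

lemma vector_field_tangent: "X \<in> \<XX> \<Longrightarrow> p \<in> topspace M \<Longrightarrow> X p \<in> tangent_space M A p"
  by (simp add: vector_fields_def)

lemma vector_field_nonsmooth: "X \<in> \<XX> \<Longrightarrow> f \<notin> \<FF> \<Longrightarrow> X p f = 0"
  by (cases "p \<in> topspace M") (auto simp: vector_fields_def tangent_space_def)

lemma smooth_functions_derivative: "X \<in> \<XX> \<Longrightarrow> f \<in> \<FF> \<Longrightarrow> (\<lambda>p. X p f) \<in> \<FF>"
  by (simp add: vector_fields_def)

lemma derivative_add:
  assumes "X \<in> \<XX>" "f \<in> \<FF>" "h \<in> \<FF>" shows "X p (\<lambda>q. f q + h q) = X p f + X p h"
  using assms vector_field_tangent[OF assms(1), of p] vector_field_outside[OF assms(1), of p]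
  by (cases "p \<in> topspace M") (auto simp: tangent_space_def plus_fun_def)

lemma derivative_cmult:
  assumes "X \<in> \<XX>" "f \<in> \<FF>" shows "X p (\<lambda>q. c * f q) = c * X p f"
  using assms vector_field_tangent[OF assms(1), of p] vector_field_outside[OF assms(1), of p]
  by (cases "p \<in> topspace M") (auto simp: tangent_space_def)

lemma derivative_zero: "X \<in> \<XX> \<Longrightarrow> X p (\<lambda>_. 0) = 0"
  using derivative_cmult[OF _ smooth_functions_const[of 0], of X p 0] by simp

lemma derivative_mult:
  assumes "X \<in> \<XX>" "f \<in> \<FF>" "h \<in> \<FF>"
  shows "X p (\<lambda>q. f q * h q) = f p * X p h + h p * X p f"
  using assms vector_field_tangent[OF assms(1), of p] vector_field_outside[OF assms(1), of p]
  by (cases "p \<in> topspace M") (auto simp: tangent_space_def times_fun_def)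

lemma vector_fields_add: "X \<in> \<XX> \<Longrightarrow> Y \<in> \<XX> \<Longrightarrow> X + Y \<in> \<XX>"
  by (auto simp: vector_fields_def tangent_space_add smooth_functions_add)

lemma vector_fields_scale: "f \<in> \<FF> \<Longrightarrow> X \<in> \<XX> \<Longrightarrow> f \<odot> X \<in> \<XX>"
  by (auto simp: vector_fields_def fun_scale_def tangent_space_scale smooth_functions_mult
      zero_fun_def)

lemma const_scale_eq:
  "X \<in> \<XX> \<Longrightarrow> (\<lambda>_. c) \<odot> X = (\<lambda>p. if p \<in> topspace M then c else 0) \<odot> X"
  by (auto simp: fun_scale_def fun_eq_iff vector_field_outside)

lemma vector_fields_const_scale: "X \<in> \<XX> \<Longrightarrow> (\<lambda>_. c) \<odot> X \<in> \<XX>"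
  by (simp add: const_scale_eq vector_fields_scale smooth_functions_const)

lemma vector_fields_diff: assumes "X \<in> \<XX>" "Y \<in> \<XX>" shows "X - Y \<in> \<XX>"
proof -
  have "X - Y = X + (\<lambda>_. -1) \<odot> Y"
    by (simp add: fun_eq_iff fun_scale_def)
  then show ?thesis
    by (simp only: vector_fields_add vector_fields_const_scale assms)
qed

lemma lie_bracket_tangent:
  assumes "X \<in> \<XX>" "Y \<in> \<XX>"
  shows "lie_bracket X Y p \<in> tangent_space M A p"
proof -
  note derivation_rules = assms[THEN smooth_functions_derivative] assms[THEN derivative_add]
    assms[THEN derivative_cmult] assms[THEN derivative_mult] smooth_functions_mult
  have "lie_bracket X Y p (\<lambda>q. f q + h q) = lie_bracket X Y p f + lie_bracket X Y p h"
    if "f \<in> \<FF>" "h \<in> \<FF>" for f h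
    by (simp add: lie_bracket_def derivation_rules that)
  moreover have "lie_bracket X Y p (\<lambda>q. c * f q) = c * lie_bracket X Y p f" if "f \<in> \<FF>" for c f
    by (simp add: lie_bracket_def derivation_rules that algebra_simps)
  moreover have "lie_bracket X Y p (\<lambda>q. f q * h q)
      = f p * lie_bracket X Y p h + h p * lie_bracket X Y p f" if "f \<in> \<FF>" "h \<in> \<FF>" for f h
    by (simp add: lie_bracket_def derivation_rules that algebra_simps)
  moreover have "lie_bracket X Y p f = 0" if "f \<notin> \<FF>" for f
    by (simp add: lie_bracket_def vector_field_nonsmooth derivative_zero assms that)
  ultimately show ?thesis
    by (simp add: tangent_space_def plus_fun_def times_fun_def)
qed

lemma vector_fields_lie_bracket:
  assumes "X \<in> \<XX>" "Y \<in> \<XX>" shows "lie_bracket X Y \<in> \<XX>"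
proof -
  have "lie_bracket X Y p = 0" if "p \<notin> topspace M" for p
    by (simp add: lie_bracket_def fun_eq_iff vector_field_outside assms that)
  moreover have "(\<lambda>p. lie_bracket X Y p f) \<in> \<FF>" if "f \<in> \<FF>" for f
    by (simp add: lie_bracket_def smooth_functions_diff smooth_functions_derivative assms that)
  ultimately show ?thesis
    using lie_bracket_tangent[OF assms] by (simp add: vector_fields_def)
qed

end

section \<open>Linear connections and their curvature\<close>

definition curvature_action ::
    "'a connection \<Rightarrow> ('a vfield \<Rightarrow> 'a vfield \<Rightarrow> 'a vfield \<Rightarrow> 'a vfield)
      \<Rightarrow> 'a vfield \<Rightarrow> 'a vfield \<Rightarrow> 'a vfield \<Rightarrow> 'a vfield \<Rightarrow> 'a vfield \<Rightarrow> 'a vfield"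
  where "curvature_action D T X Y Z U V =
    curvature D X Y (T Z U V) - T (curvature D X Y Z) U V - T Z (curvature D X Y U) V
    - T Z U (curvature D X Y V)"

lemma semi_symmetric_iff_curvature_action:
  "semi_symmetric M A D \<longleftrightarrow>
    (\<forall>X\<in>vector_fields M A. \<forall>Y\<in>vector_fields M A. \<forall>Z\<in>vector_fields M A.
     \<forall>U\<in>vector_fields M A. \<forall>V\<in>vector_fields M A.
       curvature_action D (curvature D) X Y Z U V = 0)"
  by (simp add: semi_symmetric_def curvature_action_def)

locale manifold_connection = manifold_atlas M A
  for M :: "'a topology" and A :: "('a, 'e::euclidean_space) chart set" +
  fixes D :: "'a connection"
  assumes linear_connection: "linear_connection M A D"
begin

abbreviation "R \<equiv> curvature D"

lemma connection_closed: "X \<in> \<XX> \<Longrightarrow> Y \<in> \<XX> \<Longrightarrow> D X Y \<in> \<XX>"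
  and connection_add_left: "X \<in> \<XX> \<Longrightarrow> Y \<in> \<XX> \<Longrightarrow> Z \<in> \<XX> \<Longrightarrow> D (X + Y) Z = D X Z + D Y Z"
  and connection_scale_left: "f \<in> \<FF> \<Longrightarrow> X \<in> \<XX> \<Longrightarrow> Y \<in> \<XX> \<Longrightarrow> D (f \<odot> X) Y = f \<odot> D X Y"
  and connection_add_right: "X \<in> \<XX> \<Longrightarrow> Y \<in> \<XX> \<Longrightarrow> Z \<in> \<XX> \<Longrightarrow> D X (Y + Z) = D X Y + D X Z"
  and connection_const_scale_right:
    "X \<in> \<XX> \<Longrightarrow> Y \<in> \<XX> \<Longrightarrow> D X ((\<lambda>_. c) \<odot> Y) = (\<lambda>_. c) \<odot> D X Y"
  and connection_leibniz:
    "f \<in> \<FF> \<Longrightarrow> X \<in> \<XX> \<Longrightarrow> Y \<in> \<XX> \<Longrightarrow> D X (f \<odot> Y) = (\<lambda>p. X p f) \<odot> Y + f \<odot> D X Y"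
  using linear_connection by (simp_all add: linear_connection_def)

lemma connection_zero_right: assumes "X \<in> \<XX>" shows "D X 0 = 0"
proof -
  have zero_scale: "(\<lambda>_. 0) \<odot> Y = 0" for Y :: "'a vfield"
    by (simp add: fun_eq_iff fun_scale_def)
  show ?thesis
    using connection_const_scale_right[OF assms assms, of 0] by (simp only: zero_scale)
qed

lemma curvature_closed: "X \<in> \<XX> \<Longrightarrow> Y \<in> \<XX> \<Longrightarrow> Z \<in> \<XX> \<Longrightarrow> R X Y Z \<in> \<XX>"
  by (simp add: curvature_def vector_fields_diff connection_closed vector_fields_lie_bracket)

lemma curvature_add:
  "X \<in> \<XX> \<Longrightarrow> Y \<in> \<XX> \<Longrightarrow> Z \<in> \<XX> \<Longrightarrow> W \<in> \<XX> \<Longrightarrow> R X Y (Z + W) = R X Y Z + R X Y W"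
  by (simp add: curvature_def connection_add_right connection_closed vector_fields_lie_bracket)

lemma curvature_diff:
  assumes "X \<in> \<XX>" "Y \<in> \<XX>" "Z \<in> \<XX>" "W \<in> \<XX>" shows "R X Y (Z - W) = R X Y Z - R X Y W"
  using curvature_add[OF assms(1,2) vector_fields_diff[OF assms(3,4)] assms(4)] by simp

lemma curvature_scale:
  assumes f: "f \<in> \<FF>" and "X \<in> \<XX>" "Y \<in> \<XX>" "Z \<in> \<XX>"
  shows "R X Y (f \<odot> Z) = f \<odot> R X Y Z"
proof -
  note fields = assms connection_closed smooth_functions_derivative vector_fields_lie_bracket
    vector_fields_scale
  have second_derivative: "D X (D Y (f \<odot> Z)) = (\<lambda>p. X p (\<lambda>q. Y q f)) \<odot> Z + (\<lambda>p. Y p f) \<odot> D X Z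
      + (\<lambda>p. X p f) \<odot> D Y Z + f \<odot> D X (D Y Z)" if "X \<in> \<XX>" "Y \<in> \<XX>" for X Y
    by (simp add: connection_leibniz connection_add_right fields that)
  show ?thesis
    unfolding curvature_def second_derivative[OF assms(2,3)] second_derivative[OF assms(3,2)]
    by (simp add: connection_leibniz fields)
       (simp add: fun_eq_iff fun_scale_def lie_bracket_def algebra_simps)
qed

lemma curvature_const_scale:
  "X \<in> \<XX> \<Longrightarrow> Y \<in> \<XX> \<Longrightarrow> Z \<in> \<XX> \<Longrightarrow> R X Y ((\<lambda>_. c) \<odot> Z) = (\<lambda>_. c) \<odot> R X Y Z"
  by (simp add: const_scale_eq curvature_scale smooth_functions_const curvature_closed)

lemma curvature_zero: "X \<in> \<XX> \<Longrightarrow> Y \<in> \<XX> \<Longrightarrow> R X Y 0 = 0"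
  using curvature_diff[of X Y X X] by simp

lemma curvature_parallel:
  assumes "parallel_vector_field M A D \<xi>" "X \<in> \<XX>" "Y \<in> \<XX>" shows "R X Y \<xi> = 0"
  using assms
  by (simp add: curvature_def parallel_vector_field_def connection_zero_right
      vector_fields_lie_bracket)

end

section \<open>One-forms and the connections they induce\<close>

definition smooth_one_form ::
    "'a topology \<Rightarrow> ('a, 'e::euclidean_space) chart set \<Rightarrow> ('a vfield \<Rightarrow> 'a \<Rightarrow> real) \<Rightarrow> bool"
  where "smooth_one_form M A \<eta> \<longleftrightarrow>
    (\<forall>X\<in>vector_fields M A. \<eta> X \<in> smooth_functions M A) \<and>
    (\<forall>X\<in>vector_fields M A. \<forall>Y\<in>vector_fields M A. \<eta> (X + Y) = \<eta> X + \<eta> Y) \<and>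
    (\<forall>f\<in>smooth_functions M A. \<forall>X\<in>vector_fields M A. \<eta> (f \<odot> X) = f * \<eta> X)"

definition parallel_one_form ::
    "'a topology \<Rightarrow> ('a, 'e::euclidean_space) chart set \<Rightarrow> 'a connection
      \<Rightarrow> ('a vfield \<Rightarrow> 'a \<Rightarrow> real) \<Rightarrow> bool"
  where "parallel_one_form M A D \<eta> \<longleftrightarrow>
    (\<forall>X\<in>vector_fields M A. \<forall>Y\<in>vector_fields M A. (\<lambda>p. X p (\<eta> Y)) = \<eta> (D X Y))"

definition one_form_deformation ::
    "real \<Rightarrow> real \<Rightarrow> ('a vfield \<Rightarrow> 'a \<Rightarrow> real) \<Rightarrow> 'a connection \<Rightarrow> 'a connection"
  where "one_form_deformation a b \<eta> D X Y =
    D X Y + (\<lambda>p. a * \<eta> Y p) \<odot> X + (\<lambda>p. b * \<eta> X p) \<odot> Y"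

lemma projective_semi_symmetric_connection_eq_deformation:
  "projective_semi_symmetric_connection n \<pi> D
    = one_form_deformation (real n / (real n + 1)) (- 1 / (real n + 1)) \<pi> D"
proof -
  define c where "c = (real n - 1) / (2 * (real n + 1))"
  have coefficients: "real n / (real n + 1) = c + 1 / 2" "- 1 / (real n + 1) = c - 1 / 2"
    by (simp_all add: c_def field_simps)
  show ?thesis
    unfolding coefficients projective_semi_symmetric_connection_def c_def[symmetric] Let_def
    by (simp add: one_form_deformation_def fun_eq_iff fun_scale_def algebra_simps)
qed

locale connection_with_one_form = manifold_connection M A D
  for M :: "'a topology" and A :: "('a, 'e::euclidean_space) chart set"
    and D :: "'a connection" +
  fixes \<eta> :: "'a vfield \<Rightarrow> 'a \<Rightarrow> real"
  assumes smooth_one_form: "smooth_one_form M A \<eta>"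
begin

lemma one_form_smooth: "X \<in> \<XX> \<Longrightarrow> \<eta> X \<in> \<FF>"
  and one_form_add: "X \<in> \<XX> \<Longrightarrow> Y \<in> \<XX> \<Longrightarrow> \<eta> (X + Y) = \<eta> X + \<eta> Y"
  and one_form_scale: "f \<in> \<FF> \<Longrightarrow> X \<in> \<XX> \<Longrightarrow> \<eta> (f \<odot> X) = f * \<eta> X"
  using smooth_one_form by (simp_all add: smooth_one_form_def)

lemma one_form_diff: "X \<in> \<XX> \<Longrightarrow> Y \<in> \<XX> \<Longrightarrow> \<eta> (X - Y) = \<eta> X - \<eta> Y"
  using one_form_add[of "X - Y" Y] vector_fields_diff[of X Y] by simp

lemma one_form_const_scale: "X \<in> \<XX> \<Longrightarrow> \<eta> ((\<lambda>_. c) \<odot> X) = (\<lambda>p. c * \<eta> X p)"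
  by (auto simp: const_scale_eq one_form_scale smooth_functions_const fun_eq_iff
      smooth_function_outside[OF one_form_smooth])

lemma derivative_parallel_one_form:
  "parallel_one_form M A D \<eta> \<Longrightarrow> X \<in> \<XX> \<Longrightarrow> Y \<in> \<XX> \<Longrightarrow> X p (\<eta> Y) = \<eta> (D X Y) p"
  by (simp add: parallel_one_form_def fun_eq_iff)

lemma parallel_one_form_curvature:
  assumes "parallel_one_form M A D \<eta>" "X \<in> \<XX>" "Y \<in> \<XX>" "Z \<in> \<XX>" shows "\<eta> (R X Y Z) = 0"
proof -
  note derivative_\<eta> = derivative_parallel_one_form[OF assms(1)]
  have "\<eta> (D X (D Y Z)) p - \<eta> (D Y (D X Z)) p = lie_bracket X Y p (\<eta> Z)" for p
    by (simp add: lie_bracket_def derivative_\<eta> connection_closed assms(2-4))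
  also have "lie_bracket X Y p (\<eta> Z) = \<eta> (D (lie_bracket X Y) Z) p" for p
    by (simp add: derivative_\<eta> vector_fields_lie_bracket assms(2-4))
  finally show ?thesis
    by (simp add: curvature_def one_form_diff vector_fields_diff connection_closed
        vector_fields_lie_bracket assms(2-4) fun_eq_iff)
qed

end

locale deformed_connection = connection_with_one_form M A D \<eta>
  for M :: "'a topology" and A :: "('a, 'e::euclidean_space) chart set"
    and D :: "'a connection" and \<eta> :: "'a vfield \<Rightarrow> 'a \<Rightarrow> real" +
  fixes a b :: real
begin

abbreviation "D' \<equiv> one_form_deformation a b \<eta> D"
abbreviation "R' \<equiv> curvature D'"

lemma linear_connection_deformation: "linear_connection M A D'"
proof -
  note closure = one_form_smooth smooth_functions_cmult vector_fields_add vector_fields_scale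
    connection_closed
  note linearity = connection_add_left connection_scale_left connection_add_right
    connection_const_scale_right connection_leibniz one_form_add one_form_scale one_form_const_scale
  have "D' X Y \<in> \<XX>" if "X \<in> \<XX>" "Y \<in> \<XX>" for X Y
    by (simp add: one_form_deformation_def closure that)
  moreover have "D' (X + Y) Z = D' X Z + D' Y Z" "D' X (Y + Z) = D' X Y + D' X Z"
    if "X \<in> \<XX>" "Y \<in> \<XX>" "Z \<in> \<XX>" for X Y Z
    by (simp_all add: one_form_deformation_def linearity that)
       (simp_all add: fun_eq_iff fun_scale_def algebra_simps)
  moreover have "D' X ((\<lambda>_. c) \<odot> Y) = (\<lambda>_. c) \<odot> D' X Y" if "X \<in> \<XX>" "Y \<in> \<XX>" for c X Y
    by (simp add: one_form_deformation_def linearity that)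
       (simp add: fun_eq_iff fun_scale_def algebra_simps)
  moreover have "D' (f \<odot> X) Y = f \<odot> D' X Y" "D' X (f \<odot> Y) = (\<lambda>p. X p f) \<odot> Y + f \<odot> D' X Y"
    if "f \<in> \<FF>" "X \<in> \<XX>" "Y \<in> \<XX>" for f X Y
    by (simp_all add: one_form_deformation_def linearity that)
       (simp_all add: fun_eq_iff fun_scale_def algebra_simps)
  ultimately show ?thesis
    by (simp add: linear_connection_def)
qed

sublocale deformed: manifold_connection M A D'
  by unfold_locales (rule linear_connection_deformation)

end

section \<open>Deformation by a parallel one-form\<close>

locale parallel_deformation = deformed_connection M A D \<eta> a b
  for M :: "'a topology" and A :: "('a, 'e::euclidean_space) chart set"
    and D :: "'a connection" and \<eta> :: "'a vfield \<Rightarrow> 'a \<Rightarrow> real" and a b :: real +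
  assumes torsion_free: "\<And>X Y. X \<in> \<XX> \<Longrightarrow> Y \<in> \<XX> \<Longrightarrow> torsion D X Y = 0"
    and parallel_one_form: "parallel_one_form M A D \<eta>"
begin

lemma lie_bracket_eq: "X \<in> \<XX> \<Longrightarrow> Y \<in> \<XX> \<Longrightarrow> lie_bracket X Y = D X Y - D Y X"
  using torsion_free[of X Y] unfolding torsion_def by (simp only: right_minus_eq)

lemma one_form_deformation_twice:
  assumes "X \<in> \<XX>" "Y \<in> \<XX>" "Z \<in> \<XX>"
  shows "D' X (D' Y Z) p h = D X (D Y Z) p h
    + a * \<eta> (D X Z) p * Y p h + a * \<eta> Z p * D X Y p h
    + b * \<eta> (D X Y) p * Z p h + b * \<eta> Y p * D X Z p h
    + a * (\<eta> (D Y Z) p + (a + b) * \<eta> Y p * \<eta> Z p) * X p h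
    + b * \<eta> X p * (D Y Z p h + a * \<eta> Z p * Y p h + b * \<eta> Y p * Z p h)"
proof -
  note closure = assms vector_fields_add vector_fields_scale smooth_functions_cmult one_form_smooth
    connection_closed
  have "D X (D' Y Z) p h = D X (D Y Z) p h
      + a * \<eta> (D X Z) p * Y p h + a * \<eta> Z p * D X Y p h
      + b * \<eta> (D X Y) p * Z p h + b * \<eta> Y p * D X Z p h"
    by (simp add: one_form_deformation_def connection_add_right connection_leibniz closure
        derivative_cmult derivative_parallel_one_form[OF parallel_one_form])
       (simp add: fun_scale_def)
  moreover have "\<eta> (D' Y Z) p = \<eta> (D Y Z) p + (a + b) * \<eta> Y p * \<eta> Z p"
    by (simp add: one_form_deformation_def one_form_add one_form_scale closure algebra_simps)
  moreover have "D' X (D' Y Z) p h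
      = D X (D' Y Z) p h + a * \<eta> (D' Y Z) p * X p h + b * \<eta> X p * D' Y Z p h"
    by (simp add: one_form_deformation_def[of a b \<eta> D X] fun_scale_def)
  ultimately show ?thesis
    by (simp add: one_form_deformation_def fun_scale_def)
qed

lemma curvature_deformation:
  assumes "X \<in> \<XX>" "Y \<in> \<XX>" "Z \<in> \<XX>"
  shows "R' X Y Z = R X Y Z
    + (\<lambda>p. a\<^sup>2 * \<eta> Z p * \<eta> Y p) \<odot> X - (\<lambda>p. a\<^sup>2 * \<eta> Z p * \<eta> X p) \<odot> Y"
proof (intro ext)
  fix p h
  have "D' (lie_bracket X Y) Z p h = D (lie_bracket X Y) Z p h
      + a * \<eta> Z p * (D X Y p h - D Y X p h) + b * (\<eta> (D X Y) p - \<eta> (D Y X) p) * Z p h"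
    by (simp add: one_form_deformation_def fun_scale_def lie_bracket_eq one_form_diff assms
        connection_closed)
  then show "R' X Y Z p h = (R X Y Z
      + (\<lambda>p. a\<^sup>2 * \<eta> Z p * \<eta> Y p) \<odot> X - (\<lambda>p. a\<^sup>2 * \<eta> Z p * \<eta> X p) \<odot> Y) p h"
    by (simp add: curvature_def one_form_deformation_twice assms)
       (simp add: fun_scale_def algebra_simps power2_eq_square)
qed

lemma smooth_functions_one_form_mult:
  "X \<in> \<XX> \<Longrightarrow> Y \<in> \<XX> \<Longrightarrow> (\<lambda>p. c * \<eta> X p * \<eta> Y p) \<in> \<FF>"
  by (intro smooth_functions_mult smooth_functions_cmult one_form_smooth)

lemma one_form_curvature_deformation:
  assumes "X \<in> \<XX>" "Y \<in> \<XX>" "Z \<in> \<XX>" shows "\<eta> (R' X Y Z) = 0"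
  by (simp add: curvature_deformation one_form_diff one_form_add one_form_scale
      parallel_one_form_curvature[OF parallel_one_form] smooth_functions_one_form_mult
      vector_fields_add vector_fields_scale curvature_closed assms)
     (simp add: fun_eq_iff)

lemma curvature_deformation_of_kernel:
  assumes "X \<in> \<XX>" "Y \<in> \<XX>" "Z \<in> \<XX>" "\<eta> Z = 0" shows "R' X Y Z = R X Y Z"
  using assms by (simp add: curvature_deformation fun_eq_iff fun_scale_def)

lemma curvature_action_deformation:
  assumes "X \<in> \<XX>" "Y \<in> \<XX>" "Z \<in> \<XX>" "U \<in> \<XX>" "V \<in> \<XX>"
  shows "curvature_action D' R' X Y Z U V = curvature_action D' R X Y Z U V"
proof -
  define coeff where "coeff W = (\<lambda>p. a\<^sup>2 * \<eta> V p * \<eta> W p)" for W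
  note closure = assms smooth_functions_one_form_mult vector_fields_add vector_fields_scale
    curvature_closed deformed.curvature_closed
  have "R' X Y (R' Z U V) = R' X Y (R Z U V) + coeff U \<odot> R' X Y Z - coeff Z \<odot> R' X Y U"
    by (simp add: curvature_deformation[of Z U V] deformed.curvature_diff deformed.curvature_add
        deformed.curvature_scale closure coeff_def)
  moreover have "R' (R' X Y Z) U V = R (R' X Y Z) U V + coeff U \<odot> R' X Y Z"
    by (simp add: curvature_deformation[of _ U V] one_form_curvature_deformation closure coeff_def)
       (simp add: fun_eq_iff fun_scale_def)
  moreover have "R' Z (R' X Y U) V = R Z (R' X Y U) V - coeff Z \<odot> R' X Y U"
    by (simp add: curvature_deformation[of Z _ V] one_form_curvature_deformation closure coeff_def)
       (simp add: fun_eq_iff fun_scale_def)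
  moreover have "R' Z U (R' X Y V) = R Z U (R' X Y V)"
    by (simp add: curvature_deformation_of_kernel one_form_curvature_deformation closure)
  ultimately show ?thesis
    by (simp add: curvature_action_def)
qed

lemma semi_symmetric_deformation_of_flat:
  assumes "flat_connection M A D" shows "semi_symmetric M A D'"
proof -
  have "curvature_action D' R X Y Z U V = 0"
    if "X \<in> \<XX>" "Y \<in> \<XX>" "Z \<in> \<XX>" "U \<in> \<XX>" "V \<in> \<XX>" for X Y Z U V
    using assms that
    by (simp add: curvature_action_def flat_connection_def deformed.curvature_closed
        deformed.curvature_zero)
  then show ?thesis
    by (simp add: semi_symmetric_iff_curvature_action curvature_action_deformation)
qed

lemma curvature_action_deformation_parallel:
  assumes \<xi>: "\<xi> \<in> \<XX>" "parallel_vector_field M A D \<xi>" "\<And>p. p \<in> topspace M \<Longrightarrow> \<eta> \<xi> p = 1"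
    and fields: "X \<in> \<XX>" "Z \<in> \<XX>" "U \<in> \<XX>"
  shows "curvature_action D' R X \<xi> Z U \<xi> = - ((\<lambda>_. a\<^sup>2) \<odot> R Z U X)"
proof -
  have "R' X \<xi> \<xi> p h = a\<^sup>2 * X p h - a\<^sup>2 * \<eta> X p * \<xi> p h" for p h
    using \<xi>(1,3) fields(1) vector_field_outside[OF \<xi>(1), of p h]
      vector_field_outside[OF fields(1), of p h]
    by (cases "p \<in> topspace M")
       (simp_all add: curvature_deformation curvature_parallel[OF \<xi>(2)] fun_scale_def)
  then have "R' X \<xi> \<xi> = (\<lambda>_. a\<^sup>2) \<odot> X - (\<lambda>p. a\<^sup>2 * \<eta> X p) \<odot> \<xi>"
    by (simp add: fun_eq_iff fun_scale_def)
  then have "R Z U (R' X \<xi> \<xi>) = (\<lambda>_. a\<^sup>2) \<odot> R Z U X"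
    by (simp add: curvature_diff curvature_scale curvature_const_scale curvature_parallel[OF \<xi>(2)]
        vector_fields_scale vector_fields_const_scale smooth_functions_cmult one_form_smooth
        \<xi>(1) fields)
       (simp add: fun_eq_iff fun_scale_def)
  then show ?thesis
    by (simp add: curvature_action_def curvature_parallel[OF \<xi>(2)] deformed.curvature_closed
        deformed.curvature_zero \<xi>(1) fields)
qed

lemma flat_of_semi_symmetric_deformation:
  assumes "a \<noteq> 0" "semi_symmetric M A D'"
    and \<xi>: "\<xi> \<in> \<XX>" "parallel_vector_field M A D \<xi>" "\<And>p. p \<in> topspace M \<Longrightarrow> \<eta> \<xi> p = 1"
  shows "flat_connection M A D"
  unfolding flat_connection_def
proof (intro ballI)
  fix Z U X assume fields: "Z \<in> \<XX>" "U \<in> \<XX>" "X \<in> \<XX>"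
  have "(\<lambda>_. a\<^sup>2) \<odot> R Z U X = - curvature_action D' R' X \<xi> Z U \<xi>"
    by (simp add: curvature_action_deformation curvature_action_deformation_parallel \<xi> fields)
  also have "\<dots> = 0"
    using assms(2) \<xi>(1) fields by (simp add: semi_symmetric_iff_curvature_action)
  finally show "R Z U X = 0"
    using \<open>a \<noteq> 0\<close> by (simp add: fun_eq_iff fun_scale_def)
qed

end

section \<open>The one-form dual to a parallel unit vector field\<close>

lemma smooth_one_form_metric_dual:
  assumes "riemannian_metric M A g" "\<xi> \<in> vector_fields M A"
  shows "smooth_one_form M A (\<lambda>X. metric_fun M g X \<xi>)"
  using assms
  by (auto simp: smooth_one_form_def riemannian_metric_def metric_fun_def vector_fields_def
      fun_scale_def fun_eq_iff)

lemma metric_zero_right: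
  assumes "riemannian_metric M A g" "p \<in> topspace M" "v \<in> tangent_space M A p"
  shows "g p v 0 = 0"
proof -
  have zero: "0 = (\<lambda>f. 0 * v f)" "0 \<in> tangent_space M A p"
    by (simp_all add: fun_eq_iff tangent_space_def)
  have "g p v 0 = g p 0 v"
    using assms zero(2) by (simp add: riemannian_metric_def)
  also have "\<dots> = g p (\<lambda>f. 0 * v f) v"
    using zero(1) by simp
  also have "\<dots> = 0 * g p v v"
    using assms unfolding riemannian_metric_def by blast
  finally show ?thesis by simp
qed

lemma parallel_one_form_metric_dual:
  assumes "riemannian_metric M A g" "metric_connection M A g D"
    and "\<xi> \<in> vector_fields M A" "parallel_vector_field M A D \<xi>"
  shows "parallel_one_form M A D (\<lambda>X. metric_fun M g X \<xi>)"
  unfolding parallel_one_form_def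
proof (intro ballI)
  fix X Y assume fields: "X \<in> vector_fields M A" "Y \<in> vector_fields M A"
  have "metric_fun M g Y (D X \<xi>) p = 0" for p
    using metric_zero_right[OF assms(1), of p "Y p"] assms(4) fields
    by (simp add: metric_fun_def parallel_vector_field_def vector_fields_def)
  then show "(\<lambda>p. X p (metric_fun M g Y \<xi>)) = metric_fun M g (D X Y) \<xi>"
    using assms(2,3) fields
    by (auto simp: metric_connection_def fun_eq_iff)
qed

theorem theorem4p2:
  fixes M :: "'a topology"
    and A :: "('a, 'e::euclidean_space) chart set"
    and g :: "'a metric_field"
    and D :: "'a connection"
    and \<xi> :: "'a vfield"
  assumes "riemannian_manifold M A g"
    and "DIM('e) > 2"
    and "levi_civita_connection M A g D"
    and "\<xi> \<in> vector_fields M A"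
    and "unit_vector_field M g \<xi>"
    and "parallel_vector_field M A D \<xi>"
  shows "semi_symmetric M A
           (projective_semi_symmetric_connection DIM('e) (\<lambda>X. metric_fun M g X \<xi>) D)
         \<longleftrightarrow> flat_connection M A D"
proof -
  let ?\<pi> = "\<lambda>X. metric_fun M g X \<xi>" and ?n = "DIM('e)"
  have metric: "riemannian_metric M A g" "metric_connection M A g D" and atlas: "smooth_atlas M A"
    using assms(1,3)
    by (simp_all add: riemannian_manifold_def smooth_manifold_def levi_civita_connection_def)
  interpret parallel_deformation M A D ?\<pi> "real ?n / (real ?n + 1)" "- 1 / (real ?n + 1)"
  proof
    show "smooth_one_form M A ?\<pi>"
      using metric(1) assms(4) by (rule smooth_one_form_metric_dual)
    show "parallel_one_form M A D ?\<pi>"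
      using metric assms(4,6) by (rule parallel_one_form_metric_dual)
  qed (use atlas assms(3) in \<open>simp_all add: levi_civita_connection_def\<close>)
  have "real ?n / (real ?n + 1) \<noteq> 0"
    by (simp add: add_nonneg_eq_0_iff)
  moreover have "?\<pi> \<xi> p = 1" if "p \<in> topspace M" for p
    using assms(5) that by (simp add: unit_vector_field_def)
  ultimately show ?thesis
    unfolding projective_semi_symmetric_connection_eq_deformation
    using semi_symmetric_deformation_of_flat flat_of_semi_symmetric_deformation[OF _ _ assms(4,6)]
    by blast
qed

end
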